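(* Let $H$ be the bowtie graph, i.e. the graph with $5$ vertices and $6$ edges consisting of two triangles that share exactly one vertex. Then for every integer $p>4$, $$\mathrm{ex}(p,H)=\left\lfloor \frac{p^2}{4}\right\rfloor+1 .$$
   Context: Graphs are finite, undirected, without loops or multiple edges. A graph is $H$-free if it does not contain $H$ as a (not necessarily induced) subgraph. $\mathrm{ex}(p,H)$ denotes the least upper bound (maximum) of the number of edges of $H$-free graphs with exactly $p$ vertices. *)

theory Defs
  imports Complex_Main
begin

text \<open>A graph is a pair of a vertex set and a set of edges, an edge being the set of
  its two distinct end vertices.\<close>

type_synonym 'a ugraph = "'a set \<times> 'a set set"

abbreviation verts :: "'a ugraph \<Rightarrow> 'a set" where
  "verts G \<equiv> fst G"

abbreviation edges :: "'a ugraph \<Rightarrow> 'a set set" where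
  "edges G \<equiv> snd G"

definition simple_graph :: "'a ugraph \<Rightarrow> bool" where
  "simple_graph G \<longleftrightarrow> finite (verts G) \<and> edges G \<subseteq> {e. e \<subseteq> verts G \<and> card e = 2}"

definition subgraph :: "'a ugraph \<Rightarrow> 'a ugraph \<Rightarrow> bool" where
  "subgraph K G \<longleftrightarrow> simple_graph K \<and> verts K \<subseteq> verts G \<and> edges K \<subseteq> edges G"

definition isomorphic :: "'a ugraph \<Rightarrow> 'b ugraph \<Rightarrow> bool" where
  "isomorphic H K \<longleftrightarrow>
     (\<exists>f. bij_betw f (verts H) (verts K) \<and> edges K = (\<lambda>e. f ` e) ` edges H)"

definition contains_graph :: "'a ugraph \<Rightarrow> 'b ugraph \<Rightarrow> bool" where
  "contains_graph G H \<longleftrightarrow> (\<exists>K. subgraph K G \<and> isomorphic H K)"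

text \<open>Every finite graph has an isomorphic copy with vertices in \<^typ>\<open>nat\<close>, so it
  suffices to let the host graphs range over those. The set below is finite (see
  \<open>finite_ex_set\<close>), so its supremum is its maximum, provided that it is nonempty.\<close>

definition ex :: "nat \<Rightarrow> 'b ugraph \<Rightarrow> nat" where
  "ex p H = Sup {card (edges G) | G :: nat ugraph.
     simple_graph G \<and> card (verts G) = p \<and> \<not> contains_graph G H}"

lemma finite_ex_set:
  "finite {card (edges G) | G :: nat ugraph.
     simple_graph G \<and> card (verts G) = p \<and> \<not> contains_graph G H}"
proof (rule finite_subset)
  show "{card (edges G) | G :: nat ugraph.
     simple_graph G \<and> card (verts G) = p \<and> \<not> contains_graph G H} \<subseteq> {..2 ^ p}"
  proof clarsimp
    fix V :: "nat set" and E
    assume "simple_graph (V, E)"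
    then have "finite V" "E \<subseteq> Pow V"
      by (auto simp: simple_graph_def)
    then show "card E \<le> 2 ^ card V"
      by (metis card_Pow card_mono finite_Pow_iff)
  qed
qed simp

definition bowtie :: "nat ugraph" where
  "bowtie = ({0, 1, 2, 3, 4}, {{0, 1}, {0, 2}, {1, 2}, {0, 3}, {0, 4}, {3, 4}})"

lemma bowtie_simple: "simple_graph bowtie"
  by (simp add: bowtie_def simple_graph_def)

lemma bowtie_size: "card (verts bowtie) = 5" "card (edges bowtie) = 6"
  by (simp_all add: bowtie_def doubleton_eq_iff)

end

theory Submission
  imports Defs
begin

text \<open>Lower bound: add one edge inside a part of the balanced complete bipartite graph; every
  triangle uses that edge, whereas the two triangles of a bowtie share no edge.

  Upper bound: by induction on \<open>p\<close>. For \<open>p = 5\<close>, at most two edges are missing, so some vertex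
  sees all others, and one of the three disjoint perfect matchings on these others survives. For
  \<open>p > 5\<close>, a vertex of degree at most \<open>p div 2\<close> is deleted, since
  \<open>p\<^sup>2 div 4 - (p - 1)\<^sup>2 div 4 = p div 2\<close>. If there is no such vertex, every edge lies in a
  triangle and all degrees are at least 4; bowtie-freeness then forces an edge \<open>uv\<close> with three
  common neighbours, and a further triangle at one of these yields a bowtie.\<close>

section \<open>Bowties as configurations of five vertices in an edge set\<close>

definition has_bowtie :: "'a set set \<Rightarrow> bool" where
  "has_bowtie E \<longleftrightarrow> (\<exists>c a b x y. distinct [c, a, b, x, y] \<and>
     {c, a} \<in> E \<and> {c, b} \<in> E \<and> {a, b} \<in> E \<and> {c, x} \<in> E \<and> {c, y} \<in> E \<and> {x, y} \<in> E)"

lemma has_bowtieI: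
  assumes "distinct [c, a, b, x, y]"
    "{c, a} \<in> E" "{c, b} \<in> E" "{a, b} \<in> E" "{c, x} \<in> E" "{c, y} \<in> E" "{x, y} \<in> E"
  shows "has_bowtie E"
  using assms unfolding has_bowtie_def by blast

lemma has_bowtie_mono: "has_bowtie E \<Longrightarrow> E \<subseteq> F \<Longrightarrow> has_bowtie F"
  unfolding has_bowtie_def by (meson subsetD)

lemma contains_bowtie_iff:
  assumes "simple_graph G"
  shows "contains_graph G bowtie \<longleftrightarrow> has_bowtie (edges G)"
proof
  assume "contains_graph G bowtie"
  then obtain K f where K: "subgraph K G" and f: "bij_betw f (verts bowtie) (verts K)"
    and e: "edges K = (\<lambda>e. f ` e) ` edges bowtie"
    unfolding contains_graph_def isomorphic_def by blast
  have "inj_on f {0, 1, 2, 3, 4}"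
    using f by (simp add: bij_betw_def bowtie_def)
  then have "distinct [f 0, f 1, f 2, f 3, f 4]"
    by (simp add: inj_on_def)
  moreover have "(\<lambda>e. f ` e) ` edges bowtie \<subseteq> edges G"
    using K e by (simp add: subgraph_def)
  ultimately show "has_bowtie (edges G)"
    by (intro has_bowtieI[of "f 0" "f 1" "f 2" "f 3" "f 4"]) (simp_all add: bowtie_def)
next
  assume "has_bowtie (edges G)"
  then obtain c a b x y where d: "distinct [c, a, b, x, y]"
    and E: "{c, a} \<in> edges G" "{c, b} \<in> edges G" "{a, b} \<in> edges G"
      "{c, x} \<in> edges G" "{c, y} \<in> edges G" "{x, y} \<in> edges G"
    unfolding has_bowtie_def by blast
  \<comment> \<open>The numbering follows \<open>bowtie\<close>: 0 is the shared vertex, and 1, 2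
    and 3, 4 are the remaining vertices of the two triangles.\<close>
  define f where "f n = [c, a, b, x, y] ! n" for n
  have f: "f 0 = c" "f 1 = a" "f 2 = b" "f 3 = x" "f 4 = y"
    by (simp_all add: f_def numeral_eq_Suc)
  define K where "K = (f ` verts bowtie, (\<lambda>e. f ` e) ` edges bowtie)"
  have "f ` verts bowtie \<subseteq> verts G"
    using assms E by (auto simp: f[simplified] bowtie_def simple_graph_def)
  moreover have KE: "(\<lambda>e. f ` e) ` edges bowtie \<subseteq> edges G"
    using E by (simp add: f[simplified] bowtie_def)
  moreover have "simple_graph K"
    using d by (simp add: K_def simple_graph_def bowtie_def f[simplified])
  ultimately have "subgraph K G"
    by (simp add: subgraph_def K_def)
  moreover have "inj_on f (verts bowtie)"
    using d by (simp add: bowtie_def f[simplified])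
  then have "isomorphic bowtie K"
    unfolding isomorphic_def K_def by (intro exI[of _ f]) (simp add: bij_betw_def)
  ultimately show "contains_graph G bowtie"
    unfolding contains_graph_def by blast
qed

section \<open>Bowties forced by triangles and large degrees\<close>

lemma ex_neighbour_notin:
  assumes "card S < card {u. {v, u} \<in> E}" "finite S"
  obtains u where "{v, u} \<in> E" "u \<notin> S"
proof -
  have "\<not> {u. {v, u} \<in> E} \<subseteq> S"
    using assms card_mono[of S "{u. {v, u} \<in> E}"] by linarith
  then show ?thesis
    using that by blast
qed

text \<open>Without a bowtie, triangles at a common vertex always share a second one
  (\<open>meet\<close>), while degree 4 supplies neighbours outside any three given vertices
  (\<open>nbr\<close>). Each new neighbour lies in a triangle, whose third vertex
  \<open>meet\<close> then pins down.\<close>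

lemma has_bowtie_of_triangles:
  fixes E :: "'a set set"
  assumes two: "\<And>e. e \<in> E \<Longrightarrow> card e = 2"
    and tri: "\<And>u v. {u, v} \<in> E \<Longrightarrow> \<exists>w. {u, w} \<in> E \<and> {v, w} \<in> E"
    and deg: "\<And>v. v \<in> \<Union>E \<Longrightarrow> 4 \<le> card {u. {v, u} \<in> E}"
    and "E \<noteq> {}"
  shows "has_bowtie E"
proof (rule ccontr)
  assume nb: "\<not> has_bowtie E"
  define adj where "adj a b \<longleftrightarrow> {a, b} \<in> E" for a b
  have sym: "adj b a" if "adj a b" for a b
    using that by (simp add: adj_def insert_commute)
  have ne: "a \<noteq> b" if "adj a b" for a b
    using that two[of "{a, b}"] by (auto simp: adj_def)
  have nbr: "\<exists>u. adj v u \<and> u \<notin> S" if "adj v w" "card S < 4" "finite S" for v w S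
  proof -
    have "card S < card {u. {v, u} \<in> E}"
      using deg[of v] that by (fastforce simp: adj_def)
    then show ?thesis
      using ex_neighbour_notin that(3) unfolding adj_def by metis
  qed
  have common: "\<exists>w. adj u w \<and> adj v w" if "adj u v" for u v
    using tri that by (simp add: adj_def)
  have meet: "x = a \<or> x = b \<or> y = a \<or> y = b"
    if "adj c a" "adj c b" "adj a b" "adj c x" "adj c y" "adj x y" for c a b x y
  proof (rule ccontr)
    assume "\<not> ?thesis"
    then have "distinct [c, a, b, x, y]"
      using ne that by auto
    then show False
      using nb has_bowtieI that unfolding adj_def by metis
  qed
  obtain e where "e \<in> E"
    using \<open>E \<noteq> {}\<close> by blast
  then obtain v u0 where vu0: "adj v u0"
    using two unfolding adj_def card_2_iff by metis
  obtain w0 where w0: "adj v w0" "adj u0 w0"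
    using common vu0 by blast
  obtain x where x: "adj v x" "x \<notin> {u0, w0}"
    using nbr[OF vu0, of "{u0, w0}"] ne[OF w0(2)] by auto
  obtain y where y: "adj v y" "adj x y"
    using common x by blast
  have "y = u0 \<or> y = w0"
    using meet[OF vu0 w0 x(1) y] x by blast
  \<comment> \<open>The triangle on \<open>v\<close>, \<open>x\<close>, \<open>y\<close> meets the
    first one in \<open>y\<close>. Call that vertex \<open>u\<close> and the other one
    \<open>w\<close>: both \<open>w\<close> and \<open>x\<close> are then common neighbours of
    \<open>u\<close> and \<open>v\<close>.\<close>
  then obtain u w where u: "adj v u" "adj v w" "adj u w" "adj u x" "x \<noteq> w"
    using vu0 w0 x y sym by (metis insertCI)
  obtain z where z: "adj v z" "z \<notin> {u, w, x}"
    using nbr[OF u(1), of "{u, w, x}"] ne[OF u(3)] ne[OF u(4)] u(5) by auto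
  obtain t where t: "adj v t" "adj z t"
    using common z by blast
  \<comment> \<open>As \<open>z\<close> is none of \<open>u\<close>, \<open>w\<close>,
    \<open>x\<close>, the vertex \<open>t\<close> lies in both \<open>{u, w}\<close> and
    \<open>{u, x}\<close>. So \<open>z\<close> is a third common neighbour of \<open>u\<close> and
    \<open>v\<close>.\<close>
  have "t = u"
    using meet[OF u(1,2,3) z(1) t] meet[OF u(1) x(1) u(4) z(1) t] z u(5) by auto
  then have uz: "adj u z"
    using t sym by blast
  \<comment> \<open>The further triangle is taken at \<open>w\<close>; it meets the triangle on
    \<open>w\<close>, \<open>u\<close>, \<open>v\<close> in its third vertex
    \<open>r\<close>.\<close>
  obtain s where s: "adj w s" "s \<notin> {u, v}"
    using nbr[OF sym[OF u(2)], of "{u, v}"] ne[OF u(1)] by auto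
  obtain r where r: "adj w r" "adj s r"
    using common s by blast
  have "r = u \<or> r = v"
    using meet[OF sym[OF u(3)] sym[OF u(2)] sym[OF u(1)] s(1) r] s by blast
  then show False
  proof
    assume "r = u"
    then have su: "adj u s"
      using r sym by blast
    \<comment> \<open>At \<open>u\<close>, the triangle through \<open>w\<close> and
      \<open>s\<close> must meet the triangles through \<open>v\<close>, \<open>x\<close> and
      through \<open>v\<close>, \<open>z\<close>. Only \<open>s\<close> can be the shared vertex,
      yet \<open>x\<close> and \<open>z\<close> differ. The other case exchanges \<open>u\<close>
      and \<open>v\<close>.\<close>
    have "s = x" "s = z"
      using meet[OF u(3) su s(1) sym[OF u(1)] u(4) x(1)]
        meet[OF u(3) su s(1) sym[OF u(1)] uz z(1)] s ne[OF u(2)] u(5) z(2) by auto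
    then show False
      using z by simp
  next
    assume "r = v"
    then have sv: "adj v s"
      using r sym by blast
    have "s = x" "s = z"
      using meet[OF u(2) sv s(1) u(1) x(1) u(4)]
        meet[OF u(2) sv s(1) u(1) z(1) uz] s ne[OF u(3)] u(5) z(2) by auto
    then show False
      using z by simp
  qed
qed

text \<open>Two degrees above \<open>card V div 2\<close> add up to more than \<open>card V\<close>,
  so the neighbourhoods of adjacent vertices overlap and every edge lies in a triangle. With at
  least six vertices such a degree is at least 4.\<close>

lemma has_bowtie_of_min_degree:
  assumes "finite V" and E: "\<And>e. e \<in> E \<Longrightarrow> e \<subseteq> V \<and> card e = 2"
    and "6 \<le> card V" and deg: "\<And>v. v \<in> V \<Longrightarrow> card V div 2 < card {u. {v, u} \<in> E}"
  shows "has_bowtie E"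
proof (rule has_bowtie_of_triangles)
  show "card e = 2" if "e \<in> E" for e
    using E that by blast
  show "4 \<le> card {u. {v, u} \<in> E}" if "v \<in> \<Union>E" for v
  proof -
    have "v \<in> V"
      using E that by blast
    then show ?thesis
      using deg[of v] \<open>6 \<le> card V\<close> by linarith
  qed
  show "\<exists>w. {u, w} \<in> E \<and> {v, w} \<in> E" if "{u, v} \<in> E" for u v
  proof -
    let ?N = "\<lambda>v. {u. {v, u} \<in> E}"
    have uv: "u \<in> V" "v \<in> V"
      using E that by auto
    have sub: "?N u \<subseteq> V" "?N v \<subseteq> V"
      using E by auto
    then have fin: "finite (?N u)" "finite (?N v)"
      using \<open>finite V\<close> finite_subset by blast+
    have "card (?N u \<union> ?N v) \<le> card V"
      using sub \<open>finite V\<close> by (intro card_mono) auto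
    moreover have "card (?N u) + card (?N v) = card (?N u \<union> ?N v) + card (?N u \<inter> ?N v)"
      by (rule card_Un_Int[OF fin])
    ultimately have "card (?N u \<inter> ?N v) \<noteq> 0"
      using deg[OF uv(1)] deg[OF uv(2)] by linarith
    then have "?N u \<inter> ?N v \<noteq> {}"
      by (metis card.empty)
    then show ?thesis
      by blast
  qed
  obtain v where "v \<in> V"
    using \<open>6 \<le> card V\<close> by fastforce
  then have "{u. {v, u} \<in> E} \<noteq> {}"
    using deg[of v] by (metis card.empty not_less_zero)
  then show "E \<noteq> {}"
    by blast
qed

section \<open>Five vertices: the base case\<close>

lemma has_bowtie_order_5:
  assumes V: "card V = 5" and E: "E \<subseteq> {e. e \<subseteq> V \<and> card e = 2}" and "8 \<le> card E"
  shows "has_bowtie E"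
proof -
  have "finite V"
    using V by (simp add: card_ge_0_finite)
  define M where "M = {e. e \<subseteq> V \<and> card e = 2} - E"
  have fin: "finite {e. e \<subseteq> V \<and> card e = 2}"
    using \<open>finite V\<close> by simp
  have "card {e. e \<subseteq> V \<and> card e = 2} = 10"
    using n_subsets[OF \<open>finite V\<close>] V by (simp add: choose_two)
  then have M2: "card M \<le> 2"
    unfolding M_def using E \<open>8 \<le> card E\<close> fin by (subst card_Diff_subset) (auto intro: finite_subset)
  have "finite M"
    using fin M_def by blast
  \<comment> \<open>Two missing pairs cover at most four of the five vertices.\<close>
  have "card (\<Union>M) \<le> sum card M"
    by (rule card_Union_le_sum_card)
  also have "\<dots> = 2 * card M"
    by (simp add: M_def)
  finally have "card (\<Union>M) < card V"
    using M2 V by linarith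
  moreover have "finite (\<Union>M)"
    using \<open>finite V\<close> by (rule finite_subset[rotated]) (auto simp: M_def)
  ultimately have "\<not> V \<subseteq> \<Union>M"
    using card_mono[of "\<Union>M" V] by linarith
  then obtain v where v: "v \<in> V" "v \<notin> \<Union>M"
    by blast
  have "card (V - {v}) = 4"
    using v V by simp
  then obtain a b c d where abcd: "V - {v} = {a, b, c, d}" "distinct [a, b, c, d]"
    by (auto simp: numeral_eq_Suc card_Suc_eq)
  have vs: "v \<notin> {a, b, c, d}" "{a, b, c, d} \<subseteq> V"
    using abcd by auto
  have edge: "{x, y} \<in> E \<or> {x, y} \<in> M" if "x \<in> V" "y \<in> V" "x \<noteq> y" for x y
    using that by (simp add: M_def)
  have vE: "{v, x} \<in> E" if "x \<in> {a, b, c, d}" for x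
    using edge[of v x] v that vs by blast
  \<comment> \<open>Since \<open>v\<close> sees all of \<open>a\<close>, \<open>b\<close>,
    \<open>c\<close>, \<open>d\<close>, two disjoint edges among these would form a bowtie centred
    at \<open>v\<close>. Hence each perfect matching contains a missing pair.\<close>
  have no: "{x, y} \<in> M \<or> {z, w} \<in> M"
    if "\<not> has_bowtie E" "distinct [x, y, z, w]" "{x, y, z, w} = {a, b, c, d}" for x y z w
  proof (rule ccontr)
    assume n: "\<not> ?thesis"
    have "{x, y, z, w} \<subseteq> V"
      unfolding that(3) by (rule vs(2))
    then have "{x, y} \<in> E" "{z, w} \<in> E"
      using n edge[of x y] edge[of z w] that(2) by auto
    moreover have "distinct [v, x, y, z, w]"
      using that(2,3) vs(1) by auto
    ultimately show False
      using that vE by (metis has_bowtieI insertCI)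
  qed
  show ?thesis
  proof (rule ccontr)
    assume nb: "\<not> ?thesis"
    obtain e1 where e1: "e1 \<in> M" "e1 = {a, b} \<or> e1 = {c, d}"
      using no[OF nb abcd(2)] by blast
    obtain e2 where e2: "e2 \<in> M" "e2 = {a, c} \<or> e2 = {b, d}"
      using no[OF nb, of a c b d] abcd(2) by auto
    obtain e3 where e3: "e3 \<in> M" "e3 = {a, d} \<or> e3 = {b, c}"
      using no[OF nb, of a d b c] abcd(2) by auto
    \<comment> \<open>The three matchings are pairwise disjoint, so their missing pairs
      differ.\<close>
    have "card {e1, e2, e3} = 3"
      using e1(2) e2(2) e3(2) abcd(2) by (auto simp: doubleton_eq_iff)
    moreover have "card {e1, e2, e3} \<le> card M"
      using e1 e2 e3 \<open>finite M\<close> by (intro card_mono) auto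
    ultimately show False
      using M2 by simp
  qed
qed

section \<open>Upper bound by vertex deletion\<close>

lemma card_incident_edges:
  assumes "\<And>e. e \<in> E \<Longrightarrow> card e = 2"
  shows "card {e \<in> E. v \<in> e} = card {u. {v, u} \<in> E}"
proof -
  have "bij_betw (\<lambda>u. {v, u}) {u. {v, u} \<in> E} {e \<in> E. v \<in> e}"
  proof (rule bij_betwI')
    fix e assume "e \<in> {e \<in> E. v \<in> e}"
    then show "\<exists>u\<in>{u. {v, u} \<in> E}. e = {v, u}"
      using assms[of e] by (auto simp: card_2_iff insert_commute)
  qed (auto simp: doubleton_eq_iff)
  then show ?thesis
    by (simp add: bij_betw_same_card)
qed

text \<open>The growth of the bound per added vertex, matching the largest degree of a deleted
  vertex. Both sides are \<open>k * k + k\<close> for \<open>n = 2 * k\<close> and the square of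
  \<open>k + 1\<close> for \<open>n = 2 * k + 1\<close>.\<close>

lemma square_div_4_Suc: "(Suc n)\<^sup>2 div 4 = n\<^sup>2 div 4 + Suc n div 2"
proof (cases "even n")
  case True
  then obtain k where "n = 2 * k" by blast
  then show ?thesis
    by (simp add: power2_eq_square algebra_simps)
next
  case False
  then obtain k where "n = 2 * k + 1" by (elim oddE)
  then show ?thesis
    by (simp add: power2_eq_square algebra_simps)
qed

lemma card_edges_le:
  assumes "5 \<le> card V" "E \<subseteq> {e. e \<subseteq> V \<and> card e = 2}" "\<not> has_bowtie E"
  shows "card E \<le> (card V)\<^sup>2 div 4 + 1"
  using assms
proof (induction "card V" arbitrary: V E rule: nat_induct_at_least)
  \<comment> \<open>The bound is \<open>25 div 4 + 1 = 7\<close>, so a counterexample would have at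
    least eight edges.\<close>
  case base
  then show ?case
    using has_bowtie_order_5[of V E] by force
next
  case (Suc n)
  have "finite V"
    using Suc.hyps by (simp add: card_ge_0_finite)
  have E: "e \<subseteq> V \<and> card e = 2" if "e \<in> E" for e
    using that Suc.prems by blast
  have "finite E"
    using Suc.prems(1) \<open>finite V\<close> by (auto intro: finite_subset[of E "Pow V"])
  have "6 \<le> card V"
    using Suc.hyps by linarith
  then obtain v where v: "v \<in> V" "card {u. {v, u} \<in> E} \<le> card V div 2"
    using has_bowtie_of_min_degree[OF \<open>finite V\<close> E] Suc.prems(2) not_le by blast
  let ?E = "{e \<in> E. v \<notin> e}"
  have "n = card (V - {v})"
    using v Suc.hyps by simp
  moreover have "?E \<subseteq> {e. e \<subseteq> V - {v} \<and> card e = 2}"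
    using Suc.prems by auto
  moreover have "\<not> has_bowtie ?E"
    using Suc.prems(2) has_bowtie_mono[of ?E E] by blast
  ultimately have "card ?E \<le> n\<^sup>2 div 4 + 1"
    using Suc.hyps(2)[of "V - {v}" ?E] by blast
  moreover have "card E = card ?E + card {e \<in> E. v \<in> e}"
  proof -
    have "E = ?E \<union> {e \<in> E. v \<in> e}"
      by blast
    moreover have "card (?E \<union> {e \<in> E. v \<in> e}) = card ?E + card {e \<in> E. v \<in> e}"
      using \<open>finite E\<close> by (intro card_Un_disjoint) auto
    ultimately show ?thesis
      by argo
  qed
  moreover have "card {e \<in> E. v \<in> e} \<le> Suc n div 2"
    using card_incident_edges[of E v] E v Suc.hyps by simp
  ultimately show ?case
    using square_div_4_Suc[of n] Suc.hyps by simp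
qed

section \<open>Lower bound: a bipartite graph with one extra edge\<close>

lemma not_has_bowtie_bipartite_plus_edge:
  assumes "\<And>e. e \<in> E \<Longrightarrow> e = e0 \<or> (\<exists>a\<in>A. \<exists>b\<in>- A. e = {a, b})"
  shows "\<not> has_bowtie E"
proof
  assume "has_bowtie E"
  then obtain c a b x y where d: "distinct [c, a, b, x, y]"
    and E: "{c, a} \<in> E" "{c, b} \<in> E" "{a, b} \<in> E" "{c, x} \<in> E" "{c, y} \<in> E" "{x, y} \<in> E"
    unfolding has_bowtie_def by blast
  have cross: "{p, q} = e0 \<or> (p \<in> A \<longleftrightarrow> q \<notin> A)" if "{p, q} \<in> E" for p q
    using assms[OF that] by (auto simp: doubleton_eq_iff)
  \<comment> \<open>Membership in \<open>A\<close> cannot alternate around a triangle, so each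
    triangle contains \<open>e0\<close>.\<close>
  have "{c, a} = e0 \<or> {c, b} = e0 \<or> {a, b} = e0" "{c, x} = e0 \<or> {c, y} = e0 \<or> {x, y} = e0"
    using cross E by blast+
  then show False
    using d by (auto simp: doubleton_eq_iff)
qed

lemma ex_bowtie_free_graph:
  assumes "4 \<le> p"
  shows "\<exists>G :: nat ugraph. simple_graph G \<and> card (verts G) = p \<and> \<not> has_bowtie (edges G) \<and>
    card (edges G) = p\<^sup>2 div 4 + 1"
proof -
  \<comment> \<open>The smaller part \<open>{..<m}\<close> has at least two vertices as
    \<open>4 \<le> p\<close>, so it has room for the extra edge \<open>{0, 1}\<close>.\<close>
  define m where "m = p div 2"
  define B where "B = (\<lambda>(a, b). {a, b}) ` ({..<m} \<times> {m..<p})"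
  define E where "E = insert {0, 1} B"
  have m: "2 \<le> m" "m \<le> p"
    using assms by (auto simp: m_def)
  have "inj_on (\<lambda>(a, b). {a, b}) ({..<m} \<times> {m..<p})"
    by (auto simp: inj_on_def doubleton_eq_iff)
  then have "card B = m * (p - m)"
    by (simp add: B_def card_image)
  also have "\<dots> = p\<^sup>2 div 4"
  proof (cases "even p")
    case True
    then obtain k where "p = 2 * k" by blast
    then show ?thesis by (simp add: m_def power2_eq_square)
  next
    case False
    then obtain k where "p = 2 * k + 1" by (elim oddE)
    then show ?thesis by (simp add: m_def power2_eq_square algebra_simps)
  qed
  finally have "card B = p\<^sup>2 div 4" .
  \<comment> \<open>Every edge of \<open>B\<close> leaves \<open>{..<m}\<close>, whereas
    \<open>{0, 1}\<close> stays inside; so the extra edge is new and raises the count by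
    one.\<close>
  moreover have "\<not> e \<subseteq> {..<m}" if "e \<in> B" for e
    using that by (auto simp: B_def)
  then have "{0, 1} \<notin> B"
    using m by fastforce
  moreover have "finite B"
    by (simp add: B_def)
  ultimately have "card E = p\<^sup>2 div 4 + 1"
    by (simp add: E_def)
  moreover have "\<not> has_bowtie E"
    by (rule not_has_bowtie_bipartite_plus_edge[of _ "{0, 1}" "{..<m}"])
      (fastforce simp: E_def B_def)
  moreover have "simple_graph ({..<p}, E)"
    using m by (auto simp: simple_graph_def E_def B_def card_insert_if)
  ultimately show ?thesis
    by (intro exI[of _ "({..<p}, E)"]) simp
qed

section \<open>The extremal number\<close>

theorem theorem4p1:
  fixes p :: nat
  assumes "p > 4"
  shows "int (ex p bowtie) = \<lfloor>(real p)\<^sup>2 / 4\<rfloor> + 1"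
proof -
  have "ex p bowtie = p\<^sup>2 div 4 + 1"
    unfolding ex_def
  proof (rule cSup_eq_maximum)
    obtain G :: "nat ugraph" where "simple_graph G" "card (verts G) = p"
      "\<not> has_bowtie (edges G)" "card (edges G) = p\<^sup>2 div 4 + 1"
      using ex_bowtie_free_graph[of p] assms by auto
    then show "p\<^sup>2 div 4 + 1 \<in> {card (edges G) | G :: nat ugraph.
        simple_graph G \<and> card (verts G) = p \<and> \<not> contains_graph G bowtie}"
      using contains_bowtie_iff[of G] by (intro CollectI exI[of _ G]) simp
  next
    fix n
    assume "n \<in> {card (edges G) | G :: nat ugraph.
        simple_graph G \<and> card (verts G) = p \<and> \<not> contains_graph G bowtie}"
    then obtain G :: "nat ugraph" where G: "n = card (edges G)" "simple_graph G"
      "card (verts G) = p" "\<not> has_bowtie (edges G)"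
      using contains_bowtie_iff by blast
    then show "n \<le> p\<^sup>2 div 4 + 1"
      using card_edges_le[of "verts G" "edges G"] assms by (simp add: simple_graph_def)
  qed
  moreover have "\<lfloor>(real p)\<^sup>2 / 4\<rfloor> = int (p\<^sup>2 div 4)"
    using floor_divide_of_nat_eq[of "p\<^sup>2" 4, where ?'a = real] by simp
  ultimately show ?thesis
    by simp
qed

end
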